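(* Let $\Phi=\{\varphi_i\}_{i=1}^M$ be a finite family of vectors in a vector space $V$ and let $k\ge 1$ be an integer. If $\Phi$ cannot be partitioned into $k$ linearly independent sets, then there exist a partition $\{A_i\}_{i=1}^k$ of $\Phi$, a subspace $S$ of $V$, and subsets $S_i\subseteq A_i$ ($1\le i\le k$) such that: (i) $S=\operatorname{span}(S_i)$ for all $1\le i\le k$; (ii) for $J=\{\varphi\in\Phi:\varphi\in S\}$, $|J|/\dim\operatorname{span}(J)>k$; (iii) for all $1\le i\le k$, $A_i\setminus S_i$ is linearly independent.
   Context: $\Phi=\{\varphi_i\}_{i=1}^M$ is a finite indexed family (repetitions allowed); subsets, cardinalities and partitions of $\Phi$ are understood in terms of the index set $\{1,\dots,M\}$, so a subfamily with a repeated vector is linearly dependent; in particular $J$ corresponds to $\{i:\varphi_i\in S\}$. Sets of a partition are allowed to be empty. The inequality $|J|/\dim\operatorname{span}(J)>k$ is understood as $|J|>k\,\dim\operatorname{span}(J)$ (which settles its meaning when $\dim\operatorname{span}(J)=0$). *)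

theory Defs
  imports Complex_Main "HOL-Library.Disjoint_Sets"
begin

text \<open>A family \<open>\<phi>\<close> indexed by \<open>{1..M}\<close> is identified with its index set: subfamilies are sets of
  indices, so that repeated vectors count with multiplicity.\<close>

text \<open>\<^const>\<open>module.dependent\<close> concerns sets of vectors; injectivity accounts for the convention
  that a subfamily with a repeated vector is linearly dependent.\<close>

definition (in vector_space) independent_family :: "('i \<Rightarrow> 'b) \<Rightarrow> 'i set \<Rightarrow> bool"
  where "independent_family \<phi> I \<longleftrightarrow> inj_on \<phi> I \<and> independent (\<phi> ` I)"

lemma (in vector_space) independent_family_iff_sum:
  assumes "finite I"
  shows "independent_family \<phi> I \<longleftrightarrow>
    (\<forall>c. (\<Sum>i\<in>I. c i *s \<phi> i) = 0 \<longrightarrow> (\<forall>i\<in>I. c i = 0))"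
proof (intro iffI allI impI ballI)
  fix c i
  assume ind: "independent_family \<phi> I" and s: "(\<Sum>i\<in>I. c i *s \<phi> i) = 0" and i: "i \<in> I"
  have inj: "inj_on \<phi> I" and ind': "independent (\<phi> ` I)"
    using ind by (auto simp: independent_family_def)
  have "(\<Sum>v\<in>\<phi> ` I. c (the_inv_into I \<phi> v) *s v) = 0"
    using s inj by (simp add: sum.reindex the_inv_into_f_f)
  then have "c (the_inv_into I \<phi> (\<phi> i)) = 0"
    using ind' assms i by (intro independentD[where s = "\<phi> ` I" and t = "\<phi> ` I"]) auto
  then show "c i = 0"
    using inj i by (simp add: the_inv_into_f_f)
next
  assume *: "\<forall>c. (\<Sum>i\<in>I. c i *s \<phi> i) = 0 \<longrightarrow> (\<forall>i\<in>I. c i = 0)"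
  have inj: "inj_on \<phi> I"
  proof (rule inj_onI, rule ccontr)
    fix i j
    assume ij: "i \<in> I" "j \<in> I" "\<phi> i = \<phi> j" "i \<noteq> j"
    define c :: "_ \<Rightarrow> 'a" where "c = (\<lambda>l. if l = i then 1 else if l = j then - 1 else 0)"
    have "(\<Sum>l\<in>I. c l *s \<phi> l) = (\<Sum>l\<in>{i, j}. c l *s \<phi> l)"
      using assms ij by (intro sum.mono_neutral_right) (auto simp: c_def)
    also have "\<dots> = 0"
      using ij by (simp add: c_def)
    finally have "c i = 0"
      using * ij by blast
    then show False
      by (simp add: c_def)
  qed
  moreover have "independent (\<phi> ` I)"
  proof (rule independent_if_scalars_zero)
    show "finite (\<phi> ` I)"
      using assms by simp
    fix f v
    assume "(\<Sum>v\<in>\<phi> ` I. f v *s v) = 0" and v: "v \<in> \<phi> ` I"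
    then have "(\<Sum>i\<in>I. f (\<phi> i) *s \<phi> i) = 0"
      using inj by (simp add: sum.reindex)
    with * have "\<forall>i\<in>I. f (\<phi> i) = 0"
      by (elim allE[of _ "\<lambda>i. f (\<phi> i)"]) simp
    then show "f v = 0"
      using v by auto
  qed
  ultimately show "independent_family \<phi> I"
    by (simp add: independent_family_def)
qed

text \<open>Unlike in \<^const>\<open>partition_on\<close>, parts may be empty; they are indexed by \<open>{1..k}\<close>.\<close>

definition partition_into :: "nat \<Rightarrow> 'i set \<Rightarrow> (nat \<Rightarrow> 'i set) \<Rightarrow> bool"
  where "partition_into k I A \<longleftrightarrow> disjoint_family_on A {1..k} \<and> (\<Union>i\<in>{1..k}. A i) = I"

end

theory Submission
  imports Defs
begin

text \<open>Matroid partitioning by exchanges. Take disjoint independent sets \<open>P 1, \<dots>, P k\<close> of indices covering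
  as many indices as possible. By maximality an uncovered \<open>x\<close> lies in the span of every \<open>P i\<close>, and
  it can be exchanged with any element of its fundamental circuit in \<open>P i\<close>, which yields another
  maximal packing. Let \<open>R\<close> be the set of all indices left uncovered by some packing reachable from
  the given one by exchanges. An exchange does not change any of the spans of \<open>P i \<inter> R\<close>: the
  fundamental circuit consists of elements of \<open>R\<close>. Hence each \<open>P i \<inter> R\<close> spans \<open>R\<close>, and \<open>S\<close> is the
  span of \<open>R\<close>. It contains all uncovered vectors, and every \<open>P i\<close> contains a basis of it; this
  gives the strict inequality as soon as some index is uncovered.\<close>

section \<open>Independent families and spans\<close>

context vector_space
begin

lemma independent_family_subset:
  "independent_family \<phi> I \<Longrightarrow> J \<subseteq> I \<Longrightarrow> independent_family \<phi> J"
  unfolding independent_family_def by (meson image_mono independent_mono inj_on_subset)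

lemma independent_family_insertI:
  assumes "independent_family \<phi> I" and "\<phi> x \<notin> span (\<phi> ` I)"
  shows "independent_family \<phi> (insert x I)"
proof -
  have "\<phi> x \<notin> \<phi> ` I"
    using assms(2) span_base by blast
  with assms show ?thesis
    unfolding independent_family_def by (auto simp: independent_insert)
qed

lemma span_insert_exchange:
  assumes "a \<in> span (insert b B)" and "a \<notin> span B"
  shows "span (insert a B) = span (insert b B)"
  unfolding span_eq using assms in_span_insert[OF assms]
  by (auto intro: span_base)

text \<open>The indices \<open>y\<close> tested in the last hypothesis form the support of
  \<open>v\<close> over \<open>I\<close>, that is, its fundamental circuit. Once \<open>R\<close>
  contains them, the expansion of \<open>v\<close> uses only vectors from
  \<open>I \<inter> R\<close>.\<close>

lemma independent_family_span_Int:
  assumes ind: "independent_family \<phi> I" and v: "v \<in> span (\<phi> ` I)"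
    and R: "\<And>y. y \<in> I \<Longrightarrow> v \<notin> span (\<phi> ` (I - {y})) \<Longrightarrow> y \<in> R"
  shows "v \<in> span (\<phi> ` (I \<inter> R))"
proof -
  let ?B = "\<phi> ` I"
  have inj: "inj_on \<phi> I" and indB: "independent ?B"
    using ind by (auto simp: independent_family_def)
  have supp: "b \<in> \<phi> ` (I \<inter> R)" if b: "representation ?B v b \<noteq> 0" for b
  proof -
    obtain y where y: "y \<in> I" "b = \<phi> y"
      using representation_ne_zero[OF b] by auto
    \<comment> \<open>Coordinates over an independent set are unique, so an expansion of
      \<open>v\<close> avoiding \<open>y\<close> would force coefficient zero at
      \<open>b\<close>.\<close>
    have "v \<notin> span (\<phi> ` (I - {y}))"
    proof
      assume "v \<in> span (\<phi> ` (I - {y}))"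
      then have "representation ?B v = representation (\<phi> ` (I - {y})) v"
        using indB by (intro representation_extend) auto
      with b have "b \<in> \<phi> ` (I - {y})"
        using representation_ne_zero by metis
      with y inj show False
        by (auto dest: inj_onD)
    qed
    with y R show ?thesis by blast
  qed
  have "(\<Sum>b | representation ?B v b \<noteq> 0. representation ?B v b *s b) \<in> span (\<phi> ` (I \<inter> R))"
    using supp by (intro span_sum span_scale span_base) auto
  then show ?thesis
    using sum_nonzero_representation_eq[OF indB v] by simp
qed

end

section \<open>Packings and exchanges\<close>

definition (in vector_space) packing :: "('i \<Rightarrow> 'b) \<Rightarrow> 'i set \<Rightarrow> 'k set \<Rightarrow> ('k \<Rightarrow> 'i set) \<Rightarrow> bool"
  where "packing \<phi> E K P \<longleftrightarrow>
    disjoint_family_on P K \<and> (\<forall>i\<in>K. P i \<subseteq> E \<and> independent_family \<phi> (P i))"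

text \<open>Maximality counts covered indices instead of comparing covered sets by inclusion: an
  exchange changes the covered set but keeps its size.\<close>

definition (in vector_space) max_packing :: "('i \<Rightarrow> 'b) \<Rightarrow> 'i set \<Rightarrow> 'k set \<Rightarrow> ('k \<Rightarrow> 'i set) \<Rightarrow> bool"
  where "max_packing \<phi> E K P \<longleftrightarrow>
    packing \<phi> E K P \<and> (\<forall>Q. packing \<phi> E K Q \<longrightarrow> card (\<Union>i\<in>K. Q i) \<le> card (\<Union>i\<in>K. P i))"

text \<open>When \<open>\<phi> x\<close> lies in the span of \<open>P i\<close>, the span condition
  says that \<open>y\<close> is on the fundamental circuit of \<open>x\<close> in
  \<open>P i\<close>; it also keeps the new slot independent.\<close>

definition (in vector_space) exchange :: "('i \<Rightarrow> 'b) \<Rightarrow> 'i set \<Rightarrow> 'k set \<Rightarrow> ('k \<Rightarrow> 'i set) \<Rightarrow> ('k \<Rightarrow> 'i set) \<Rightarrow> bool"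
  where "exchange \<phi> E K P Q \<longleftrightarrow>
    (\<exists>i\<in>K. \<exists>x\<in>E - (\<Union>i\<in>K. P i). \<exists>y\<in>P i.
      \<phi> x \<notin> span (\<phi> ` (P i - {y})) \<and> Q = P(i := insert x (P i - {y})))"

context vector_space
begin

lemma ex_max_packing:
  assumes "finite E"
  shows "\<exists>P. max_packing \<phi> E K P"
proof -
  have "packing \<phi> E K (\<lambda>_. {})"
    by (simp add: packing_def disjoint_family_on_def independent_family_def independent_empty)
  moreover have "\<forall>P. packing \<phi> E K P \<longrightarrow> card (\<Union>i\<in>K. P i) < Suc (card E)"
    using assms by (auto simp: packing_def less_Suc_eq_le intro!: card_mono)
  ultimately show ?thesis
    unfolding max_packing_def by (rule ex_has_greatest_nat)
qed

text \<open>Otherwise \<open>x\<close> could join \<open>P i\<close>, and the enlarged packing would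
  cover one more index.\<close>

lemma max_packing_span:
  assumes fin: "finite E" and P: "max_packing \<phi> E K P"
    and x: "x \<in> E - (\<Union>i\<in>K. P i)" and i: "i \<in> K"
  shows "\<phi> x \<in> span (\<phi> ` P i)"
proof (rule ccontr)
  assume nx: "\<phi> x \<notin> span (\<phi> ` P i)"
  let ?Q = "P(i := insert x (P i))"
  have pk: "packing \<phi> E K P"
    using P by (simp add: max_packing_def)
  have "packing \<phi> E K ?Q"
    using pk x i nx independent_family_insertI[of \<phi> "P i" x]
    by (auto simp: packing_def disjoint_family_on_def)
  then have "card (\<Union>j\<in>K. ?Q j) \<le> card (\<Union>j\<in>K. P j)"
    using P unfolding max_packing_def by blast
  moreover have "(\<Union>j\<in>K. ?Q j) = insert x (\<Union>j\<in>K. P j)"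
    using i by (auto split: if_splits)
  moreover have "finite (\<Union>j\<in>K. P j)"
    using pk fin by (auto simp: packing_def intro: finite_subset)
  ultimately show False
    using x by simp
qed

text \<open>By disjointness \<open>y\<close> lies in no other slot, so the covered set gains exactly
  \<open>x\<close> and loses exactly \<open>y\<close>.\<close>

lemma exchange_max_packing:
  assumes fin: "finite E" and P: "max_packing \<phi> E K P" and PQ: "exchange \<phi> E K P Q"
  shows "max_packing \<phi> E K Q"
proof -
  obtain i x y where i: "i \<in> K" and x: "x \<in> E - (\<Union>i\<in>K. P i)" and y: "y \<in> P i"
    and nx: "\<phi> x \<notin> span (\<phi> ` (P i - {y}))" and Q: "Q = P(i := insert x (P i - {y}))"
    using PQ unfolding exchange_def by blast
  have pk: "packing \<phi> E K P"
    using P by (simp add: max_packing_def)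
  have "independent_family \<phi> (insert x (P i - {y}))"
    using pk i nx independent_family_subset[of \<phi> "P i" "P i - {y}"]
    by (auto simp: packing_def intro: independent_family_insertI)
  then have "packing \<phi> E K Q"
    using pk x i unfolding Q by (auto simp: packing_def disjoint_family_on_def)
  moreover have "(\<Union>j\<in>K. Q j) = insert x ((\<Union>j\<in>K. P j) - {y})"
    using i y x pk unfolding Q by (auto simp: packing_def disjoint_family_on_def split: if_splits)
  moreover have "finite (\<Union>j\<in>K. P j)"
    using pk fin by (auto simp: packing_def intro: finite_subset)
  moreover have "y \<in> (\<Union>j\<in>K. P j)"
    using i y by blast
  ultimately have "packing \<phi> E K Q" "card (\<Union>j\<in>K. Q j) = card (\<Union>j\<in>K. P j)"
    using x card.remove[of "\<Union>j\<in>K. P j" y] by auto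
  with P show ?thesis
    by (simp add: max_packing_def)
qed

lemma max_packing_saturated:
  assumes fin: "finite E" and P: "max_packing \<phi> E K P"
  obtains R where "E - (\<Union>i\<in>K. P i) \<subseteq> R" and "R \<subseteq> E"
    and "\<And>i. i \<in> K \<Longrightarrow> \<phi> ` R \<subseteq> span (\<phi> ` (P i \<inter> R))"
proof -
  define R where "R = {x. \<exists>Q. (exchange \<phi> E K)\<^sup>*\<^sup>* P Q \<and> x \<in> E - (\<Union>i\<in>K. Q i)}"
  have max: "max_packing \<phi> E K Q" if "(exchange \<phi> E K)\<^sup>*\<^sup>* P Q" for Q
    using that by induction (auto intro: P exchange_max_packing fin)
  \<comment> \<open>Each \<open>y\<close> in \<open>Q i\<close> on the circuit of \<open>x\<close>
    becomes uncovered once exchanged for \<open>x\<close>, hence is in \<open>R\<close>; so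
    \<open>independent_family_span_Int\<close> applies.\<close>
  have uncovered: "\<phi> x \<in> span (\<phi> ` (Q i \<inter> R))"
    if Q: "(exchange \<phi> E K)\<^sup>*\<^sup>* P Q" and x: "x \<in> E - (\<Union>i\<in>K. Q i)" and i: "i \<in> K" for Q x i
  proof (rule independent_family_span_Int)
    have pk: "packing \<phi> E K Q"
      using max[OF Q] by (simp add: max_packing_def)
    then show "independent_family \<phi> (Q i)"
      using i by (simp add: packing_def)
    show "\<phi> x \<in> span (\<phi> ` Q i)"
      using max_packing_span[OF fin max[OF Q] x i] .
    fix y assume y: "y \<in> Q i" and nx: "\<phi> x \<notin> span (\<phi> ` (Q i - {y}))"
    let ?Q = "Q(i := insert x (Q i - {y}))"
    have "exchange \<phi> E K Q ?Q"
      unfolding exchange_def using i x y nx by blast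
    with Q have "(exchange \<phi> E K)\<^sup>*\<^sup>* P ?Q"
      by simp
    moreover have "y \<in> E - (\<Union>j\<in>K. ?Q j)"
      using pk i x y by (auto simp: packing_def disjoint_family_on_def split: if_splits)
    ultimately show "y \<in> R"
      unfolding R_def by blast
  qed
  have invariant: "\<forall>j\<in>K. span (\<phi> ` (Q j \<inter> R)) = span (\<phi> ` (P j \<inter> R))"
    if "(exchange \<phi> E K)\<^sup>*\<^sup>* P Q" for Q
    using that
  proof induction
    case (step Q Q')
    obtain i x y where i: "i \<in> K" and x: "x \<in> E - (\<Union>i\<in>K. Q i)" and y: "y \<in> Q i"
      and nx: "\<phi> x \<notin> span (\<phi> ` (Q i - {y}))" and Q': "Q' = Q(i := insert x (Q i - {y}))"
      using step.hyps(2) unfolding exchange_def by blast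
    let ?B = "\<phi> ` (Q i \<inter> R - {y})"
    have sp: "\<phi> x \<in> span (\<phi> ` (Q i \<inter> R))"
      using uncovered[OF step.hyps(1) x i] .
    have nsp: "\<phi> x \<notin> span ?B"
      using nx span_mono[of ?B "\<phi> ` (Q i - {y})"] by blast
    have "x \<in> R"
      using step.hyps(1) x unfolding R_def by blast
    then have *: "Q' i \<inter> R = insert x (Q i \<inter> R - {y})"
      unfolding Q' by auto
    \<comment> \<open>If \<open>y\<close> were outside \<open>R\<close>, removing it would leave
      \<open>Q i \<inter> R\<close> unchanged, and \<open>sp\<close> would contradict
      \<open>nsp\<close>.\<close>
    have "y \<in> R"
      using sp nsp by (cases "y \<in> R") auto
    then have **: "Q i \<inter> R = insert y (Q i \<inter> R - {y})"
      using y by auto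
    have "span (insert (\<phi> x) ?B) = span (insert (\<phi> y) ?B)"
      using sp nsp ** by (intro span_insert_exchange) (metis image_insert)
    then have "span (\<phi> ` (Q' i \<inter> R)) = span (\<phi> ` (Q i \<inter> R))"
      using * ** by (metis image_insert)
    with step.IH show ?case
      by (auto simp: Q')
  qed simp
  show thesis
  proof
    show "E - (\<Union>i\<in>K. P i) \<subseteq> R" "R \<subseteq> E"
      unfolding R_def by auto
    show "\<phi> ` R \<subseteq> span (\<phi> ` (P i \<inter> R))" if "i \<in> K" for i
    proof clarify
      fix x assume "x \<in> R"
      then obtain Q where Q: "(exchange \<phi> E K)\<^sup>*\<^sup>* P Q" and x: "x \<in> E - (\<Union>i\<in>K. Q i)"
        unfolding R_def by blast
      \<comment> \<open>Membership holds at the packing \<open>Q\<close> leaving \<open>x\<close>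
        uncovered; the invariant carries it back to \<open>P\<close>.\<close>
      show "\<phi> x \<in> span (\<phi> ` (P i \<inter> R))"
        using uncovered[OF Q x that] invariant[OF Q] that by simp
    qed
  qed
qed

section \<open>From the saturated set to the partition\<close>

theorem rado_horn_partition:
  fixes \<phi> :: "'i \<Rightarrow> 'b"
  assumes fin: "finite E" and k: "k \<ge> 1"
    and no: "\<not> (\<exists>A. partition_into k E A \<and> (\<forall>i\<in>{1..k}. independent_family \<phi> (A i)))"
  shows "\<exists>A S T. partition_into k E A \<and> subspace S \<and> (\<forall>i\<in>{1..k}. T i \<subseteq> A i) \<and>
    (\<forall>i\<in>{1..k}. S = span (\<phi> ` T i)) \<and>
    card {i\<in>E. \<phi> i \<in> S} > k * dim (span (\<phi> ` {i\<in>E. \<phi> i \<in> S})) \<and>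
    (\<forall>i\<in>{1..k}. independent_family \<phi> (A i - T i))"
proof -
  let ?K = "{1..k}"
  obtain P where P: "max_packing \<phi> E ?K P"
    using ex_max_packing[OF fin] by blast
  then have pk: "packing \<phi> E ?K P"
    by (simp add: max_packing_def)
  then have disj: "disjoint_family_on P ?K" and PE: "\<And>i. i \<in> ?K \<Longrightarrow> P i \<subseteq> E"
    and ind: "\<And>i. i \<in> ?K \<Longrightarrow> independent_family \<phi> (P i)"
    by (auto simp: packing_def)
  define U where "U = E - (\<Union>i\<in>?K. P i)"
  have "U \<noteq> {}"
  proof
    assume "U = {}"
    then have "partition_into k E P"
      using disj PE unfolding partition_into_def U_def by blast
    with no ind show False
      by blast
  qed
  obtain R where UR: "U \<subseteq> R" and RE: "R \<subseteq> E"
    and R: "\<And>i. i \<in> ?K \<Longrightarrow> \<phi> ` R \<subseteq> span (\<phi> ` (P i \<inter> R))"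
    using max_packing_saturated[OF fin P] unfolding U_def by metis
  define S where "S = span (\<phi> ` R)"
  define J where "J = {i\<in>E. \<phi> i \<in> S}"
  have RJ: "R \<subseteq> J"
    using RE unfolding J_def S_def by (auto intro: span_base)
  \<comment> \<open>A squeeze: \<open>P i \<inter> R\<close> already spans \<open>S\<close>, and
    \<open>J\<close> stays inside \<open>S\<close>. It serves for \<open>J\<close>,
    \<open>P i \<inter> J\<close> and \<open>T i\<close>.\<close>
  have span_S: "span (\<phi> ` X) = S" if "i \<in> ?K" "P i \<inter> R \<subseteq> X" "X \<subseteq> J" for i X
  proof
    show "span (\<phi> ` X) \<subseteq> S"
      using that unfolding S_def J_def by (intro span_minimal) auto
    have "\<phi> ` R \<subseteq> span (\<phi> ` X)"
      using R[of i] span_mono[of "\<phi> ` (P i \<inter> R)" "\<phi> ` X"] that by blast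
    then show "S \<subseteq> span (\<phi> ` X)"
      unfolding S_def by (intro span_minimal) auto
  qed
  have "1 \<in> ?K"
    using k by simp
  then have dim_J: "span (\<phi> ` J) = S"
    using span_S RJ by blast
  \<comment> \<open>Independent and spanning \<open>S\<close>, the set \<open>P i \<inter> J\<close>
    indexes a basis of \<open>S\<close>.\<close>
  have card_PJ: "card (P i \<inter> J) = dim S" if i: "i \<in> ?K" for i
  proof -
    have "independent_family \<phi> (P i \<inter> J)"
      using ind[OF i] independent_family_subset by blast
    then have "inj_on \<phi> (P i \<inter> J)" "independent (\<phi> ` (P i \<inter> J))"
      by (auto simp: independent_family_def)
    moreover have "span (\<phi> ` (P i \<inter> J)) = S"
      using span_S[OF i, of "P i \<inter> J"] RJ by blast
    ultimately show ?thesis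
      by (metis card_image dim_span dim_eq_card_independent)
  qed
  have finP: "finite (P i \<inter> J)" for i
    using fin by (simp add: J_def)
  have "card (\<Union>i\<in>?K. P i \<inter> J) = (\<Sum>i\<in>?K. card (P i \<inter> J))"
    using disj finP by (intro card_UN_disjoint) (auto simp: disjoint_family_on_def)
  then have "card (\<Union>i\<in>?K. P i \<inter> J) = k * dim S"
    using card_PJ by simp
  \<comment> \<open>Strictness comes from \<open>U\<close>, a nonempty part of \<open>J\<close>
    missed by every slot.\<close>
  moreover have "(\<Union>i\<in>?K. P i \<inter> J) \<subset> J"
    using \<open>U \<noteq> {}\<close> UR RJ unfolding U_def by blast
  then have "card (\<Union>i\<in>?K. P i \<inter> J) < card J"
    using fin by (intro psubset_card_mono) (auto simp: J_def)
  ultimately have card_J: "card J > k * dim S"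
    by simp
  \<comment> \<open>The uncovered indices can all go to slot 1, which exists as
    \<open>k \<ge> 1\<close>: they lie in \<open>J\<close>, so \<open>T 1\<close> absorbs them and
    \<open>A i - T i\<close> stays inside \<open>P i\<close>.\<close>
  define A where "A = P(1 := P 1 \<union> U)"
  define T where "T i = A i \<inter> J" for i
  have "disjoint_family_on A ?K"
  unfolding disjoint_family_on_def
  proof (intro ballI impI)
    fix m n assume mn: "m \<in> ?K" "n \<in> ?K" "m \<noteq> n"
    have "P m \<inter> P n = {}"
      using disj mn by (rule disjoint_family_onD)
    moreover have "P m \<inter> U = {}" "P n \<inter> U = {}"
      using mn unfolding U_def by blast+
    ultimately show "A m \<inter> A n = {}"
      using \<open>m \<noteq> n\<close> unfolding A_def by auto
  qed
  moreover have "(\<Union>i\<in>?K. A i) = (\<Union>i\<in>?K. P i) \<union> U"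
    using \<open>1 \<in> ?K\<close> unfolding A_def by (auto split: if_splits)
  then have "(\<Union>i\<in>?K. A i) = E"
    using PE unfolding U_def by blast
  ultimately have "partition_into k E A"
    by (simp add: partition_into_def)
  moreover have "S = span (\<phi> ` T i)" if "i \<in> ?K" for i
  proof -
    have "P i \<inter> R \<subseteq> T i" "T i \<subseteq> J"
      using RJ by (auto simp: T_def A_def)
    then show ?thesis
      using span_S[OF that] by simp
  qed
  moreover have "independent_family \<phi> (A i - T i)" if "i \<in> ?K" for i
    using UR RJ by (intro independent_family_subset[OF ind[OF that]]) (auto simp: T_def A_def split: if_splits)
  moreover have "subspace S" "\<And>i. T i \<subseteq> A i"
    by (auto simp: S_def T_def)
  ultimately show ?thesis
    using card_J dim_J unfolding J_def by (intro exI[of _ A] exI[of _ S] exI[of _ T]) simp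
qed

end

theorem corollary3p4:
  fixes scale :: "'a::field \<Rightarrow> 'b::ab_group_add \<Rightarrow> 'b"
    and \<phi> :: "nat \<Rightarrow> 'b" and M k :: nat
  assumes "vector_space scale"
    and "k \<ge> 1"
    and "\<not> (\<exists>A. partition_into k {1..M} A \<and>
               (\<forall>i\<in>{1..k}. vector_space.independent_family scale \<phi> (A i)))"
  shows "\<exists>A S T. partition_into k {1..M} A \<and> module.subspace scale S \<and>
           (\<forall>i\<in>{1..k}. T i \<subseteq> A i) \<and>
           (\<forall>i\<in>{1..k}. S = module.span scale (\<phi> ` T i)) \<and>
           (let J = {i\<in>{1..M}. \<phi> i \<in> S}
            in card J > k * vector_space.dim scale (module.span scale (\<phi> ` J))) \<and>
           (\<forall>i\<in>{1..k}. vector_space.independent_family scale \<phi> (A i - T i))"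
  unfolding Let_def
  using vector_space.rado_horn_partition[OF assms(1) finite_atLeastAtMost assms(2,3)] .

end
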